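(* Independent sets can be learned by equivalence queries in $O(n^2)$ rounds: there is a learning algorithm that makes only (non-extended) equivalence queries, with hypotheses that are graphs on $\{1,\dots,n\}$, and that, for every graph $G$ on $\{1,\dots,n\}$ and every competent Teacher, produces a hypothesis graph equivalent to $G$ with respect to the independent set concept after $O(n^2)$ queries.
   Context: A vertex set concept is a predicate $\Phi(G,V')$ on finite graphs $G$ and sets $V'\subseteq V(G)$; its solution set is $S(G)=\{V'\subseteq V(G):\Phi(G,V')\}$. Graphs $G,H$ are $\Phi$-equivalent if $V(G)=V(H)$ and $S(G)=S(H)$. Here $\Phi(G,V')$ means "$V'$ is an independent set of $G$", i.e. no two vertices of $V'$ are adjacent in $G$. Learning model (exact learning by equivalence queries): a Teacher privately holds a graph $G$ with vertex set $V=\{1,\dots,n\}$, and the Learner initially knows only $n$. In an equivalence query the Learner presents a hypothesis graph $H$ on $\{1,\dots,n\}$. If $H$ is $\Phi$-equivalent to $G$, the Teacher answers "finished". Otherwise the Teacher returns a counterexample: either a positive counterexample, i.e. a set $V'$ with $\Phi(G,V')$ true and $\Phi(H,V')$ false, or a negative counterexample, i.e. a set $V'$ with $\Phi(H,V')$ true and $\Phi(G,V')$ false. A Teacher is competent if it always answers queries correctly; it may choose any valid counterexample. A learning algorithm for $\Phi$ is a Learner strategy that, against every competent Teacher and every graph $G$, eventually obtains the answer "finished". It runs in $f(n)$ rounds if, for every graph of order $n$ and every competent Teacher, it finishes after at most $f(n)$ queries. *)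

theory Defs
  imports "Graph_Theory.Pair_Digraph" "HOL-Library.Landau_Symbols"
begin

text \<open>
  A finite simple graph is a \<open>pair_graph\<close>: a finite, loop-free digraph with symmetric arc relation.
\<close>

type_synonym ngraph = "nat pair_pre_digraph"

definition graph_on :: "nat \<Rightarrow> ngraph \<Rightarrow> bool" where
  "graph_on n G \<longleftrightarrow> pair_graph G \<and> pverts G = {1..n}"

type_synonym set_concept = "ngraph \<Rightarrow> nat set \<Rightarrow> bool"

definition solutions :: "set_concept \<Rightarrow> ngraph \<Rightarrow> nat set set" where
  "solutions \<Phi> G = {V'. V' \<subseteq> pverts G \<and> \<Phi> G V'}"

definition concept_equivalent :: "set_concept \<Rightarrow> ngraph \<Rightarrow> ngraph \<Rightarrow> bool" where
  "concept_equivalent \<Phi> G H \<longleftrightarrow> pverts G = pverts H \<and> solutions \<Phi> G = solutions \<Phi> H"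

definition independent_set :: set_concept where
  "independent_set G V' \<longleftrightarrow> V' \<subseteq> pverts G \<and> (\<forall>u\<in>V'. \<forall>v\<in>V'. \<not> u \<rightarrow>\<^bsub>with_proj G\<^esub> v)"

datatype answer = Finished | Positive "nat set" | Negative "nat set"

fun correct_answer :: "set_concept \<Rightarrow> ngraph \<Rightarrow> ngraph \<Rightarrow> answer \<Rightarrow> bool" where
  "correct_answer \<Phi> G H Finished \<longleftrightarrow> concept_equivalent \<Phi> G H"
| "correct_answer \<Phi> G H (Positive V') \<longleftrightarrow> V' \<in> solutions \<Phi> G \<and> V' \<notin> solutions \<Phi> H"
| "correct_answer \<Phi> G H (Negative V') \<longleftrightarrow> V' \<in> solutions \<Phi> H \<and> V' \<notin> solutions \<Phi> G"

text \<open>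
  A history lists the past queries with their answers, oldest first. The Learner's next
  hypothesis depends only on \<open>n\<close> and the history; the Teacher may be adaptive, choosing its
  answer depending on the history as well as on the current hypothesis.
\<close>

type_synonym history = "(ngraph \<times> answer) list"
type_synonym learner = "nat \<Rightarrow> history \<Rightarrow> ngraph"
type_synonym teacher = "history \<Rightarrow> ngraph \<Rightarrow> answer"

definition learner_strategy :: "learner \<Rightarrow> bool" where
  "learner_strategy L \<longleftrightarrow> (\<forall>n h. graph_on n (L n h))"

definition competent :: "set_concept \<Rightarrow> nat \<Rightarrow> ngraph \<Rightarrow> teacher \<Rightarrow> bool" where
  "competent \<Phi> n G T \<longleftrightarrow> (\<forall>h H. graph_on n H \<longrightarrow> correct_answer \<Phi> G H (T h H))"

text \<open>
  For convenience the interaction is continued forever; what happens after the first answer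
  \<open>Finished\<close> is irrelevant. Queries are numbered from 0.
\<close>

primrec play :: "learner \<Rightarrow> teacher \<Rightarrow> nat \<Rightarrow> nat \<Rightarrow> history" where
  "play L T n 0 = []"
| "play L T n (Suc k) =
     (let h = play L T n k; H = L n h in h @ [(H, T h H)])"

definition query :: "learner \<Rightarrow> teacher \<Rightarrow> nat \<Rightarrow> nat \<Rightarrow> ngraph" where
  "query L T n k = L n (play L T n k)"

definition reply :: "learner \<Rightarrow> teacher \<Rightarrow> nat \<Rightarrow> nat \<Rightarrow> answer" where
  "reply L T n k = T (play L T n k) (query L T n k)"

definition learning_algorithm :: "set_concept \<Rightarrow> learner \<Rightarrow> bool" where
  "learning_algorithm \<Phi> L \<longleftrightarrow> learner_strategy L \<and>
     (\<forall>n G T. graph_on n G \<longrightarrow> competent \<Phi> n G T \<longrightarrow> (\<exists>k. reply L T n k = Finished))"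

definition runs_in_rounds :: "set_concept \<Rightarrow> learner \<Rightarrow> (nat \<Rightarrow> nat) \<Rightarrow> bool" where
  "runs_in_rounds \<Phi> L f \<longleftrightarrow>
     (\<forall>n G T. graph_on n G \<longrightarrow> competent \<Phi> n G T \<longrightarrow>
        (\<exists>k<f n. reply L T n k = Finished \<and> concept_equivalent \<Phi> G (query L T n k)))"

end

theory Submission
  imports Defs
begin

text \<open>
  Start from the complete graph and, on each positive counterexample, delete all edges inside it.
  The hypothesis then always contains the hidden graph, so negative counterexamples cannot occur,
  and each positive counterexample deletes at least one edge.
\<close>

definition hypothesis :: learner where
  "hypothesis n h =
     \<lparr>pverts = {1..n},
      parcs = {(u, v). u \<in> {1..n} \<and> v \<in> {1..n} \<and> u \<noteq> v \<and>
                 (\<forall>V. Positive V \<in> snd ` set h \<longrightarrow> \<not> {u, v} \<subseteq> V)}\<rparr>"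

text \<open>Puts independence in a form that is visibly antitone in the arc set, which is all the
  comparison of hidden graph and hypothesis relies on.\<close>

lemma independent_set_iff_parcs:
  "independent_set G V \<longleftrightarrow> V \<subseteq> pverts G \<and> parcs G \<inter> V \<times> V = {}"
  by (auto simp: independent_set_def)

text \<open>Replaces the locale by conditions on the arc relation that can be checked directly for a
  hypothesis. Finiteness comes from the arcs lying in a finite square.\<close>

lemma graph_on_iff:
  "graph_on n G \<longleftrightarrow>
     pverts G = {1..n} \<and> parcs G \<subseteq> {1..n} \<times> {1..n} \<and> irrefl (parcs G) \<and> sym (parcs G)"
proof
  assume "graph_on n G"
  then interpret pair_graph G
    by (simp add: graph_on_def)
  show "pverts G = {1..n} \<and> parcs G \<subseteq> {1..n} \<times> {1..n} \<and> irrefl (parcs G) \<and> sym (parcs G)"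
    using \<open>graph_on n G\<close> in_arcsD1 in_arcsD2 no_loops arcs_symmetric
    by (fastforce simp: graph_on_def irrefl_def sym_def)
next
  assume *: "pverts G = {1..n} \<and> parcs G \<subseteq> {1..n} \<times> {1..n} \<and> irrefl (parcs G) \<and> sym (parcs G)"
  then have "finite (parcs G)"
    by (meson finite_SigmaI finite_atLeastAtMost finite_subset)
  with * have "pair_graph G"
    by unfold_locales (auto simp: irrefl_def symmetric_def dest: symD)
  with * show "graph_on n G"
    by (simp add: graph_on_def)
qed

lemma graph_on_hypothesis: "graph_on n (hypothesis n h)"
  by (auto simp: graph_on_iff hypothesis_def irrefl_def sym_def)

lemma correct_reply:
  assumes "competent \<Phi> n G T"
  shows "correct_answer \<Phi> G (query hypothesis T n k) (reply hypothesis T n k)"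
  using assms graph_on_hypothesis by (simp add: competent_def reply_def query_def)

text \<open>\<open>hypothesis\<close> is recomputed from the whole history; since one round appends
  a single answer, this amounts to an incremental update.\<close>

lemma parcs_query_Suc:
  "parcs (query hypothesis T n (Suc k)) =
     (case reply hypothesis T n k of
        Positive V \<Rightarrow> parcs (query hypothesis T n k) - V \<times> V
      | _ \<Rightarrow> parcs (query hypothesis T n k))"
  by (auto simp: query_def reply_def hypothesis_def Let_def split: answer.split)

text \<open>A correct positive counterexample is independent in \<open>G\<close>, so removing
  \<open>V \<times> V\<close> never removes an arc of \<open>G\<close>.\<close>

lemma parcs_subset_query:
  assumes "graph_on n G" "competent independent_set n G T"
  shows "parcs G \<subseteq> parcs (query hypothesis T n k)"
proof (induction k)
  case 0
  then show ?case
    using assms(1) by (auto simp: query_def hypothesis_def graph_on_iff irrefl_def)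
next
  case (Suc k)
  then show ?case
    using correct_reply[OF assms(2), of k]
    by (auto simp: parcs_query_Suc solutions_def independent_set_iff_parcs split: answer.split)
qed

lemma card_parcs_query_decreases:
  assumes "graph_on n G" "competent independent_set n G T"
    and "reply hypothesis T n k \<noteq> Finished"
  shows "card (parcs (query hypothesis T n (Suc k))) < card (parcs (query hypothesis T n k))"
proof -
  let ?H = "query hypothesis T n k"
  have H: "graph_on n ?H"
    by (simp add: query_def graph_on_hypothesis)
  have verts: "pverts G = pverts ?H"
    using assms(1) H by (simp add: graph_on_iff)
  \<comment> \<open>A negative counterexample would violate this inclusion.\<close>
  have "solutions independent_set ?H \<subseteq> solutions independent_set G"
    using parcs_subset_query[OF assms(1,2), of k] verts
    by (fastforce simp: solutions_def independent_set_iff_parcs)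
  then obtain V where V: "reply hypothesis T n k = Positive V"
    and "V \<in> solutions independent_set G" "V \<notin> solutions independent_set ?H"
    using correct_reply[OF assms(2), of k] assms(3)
    by (cases "reply hypothesis T n k") auto
  \<comment> \<open>Being a solution of \<open>G\<close>, \<open>V\<close> consists of vertices of
    \<open>?H\<close>, so only an arc inside \<open>V\<close> can keep it from being independent
    there.\<close>
  then have "parcs ?H \<inter> V \<times> V \<noteq> {}"
    using verts by (auto simp: solutions_def independent_set_iff_parcs)
  then have "parcs (query hypothesis T n (Suc k)) \<subset> parcs ?H"
    by (auto simp: parcs_query_Suc V)
  moreover have "finite (parcs ?H)"
    using H finite_subset[of _ "{1..n} \<times> {1..n}"] by (simp add: graph_on_iff)
  ultimately show ?thesis
    by (simp add: psubset_card_mono)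
qed

text \<open>There are at most \<open>n ^ 2\<close> arcs to lose, hence at most \<open>n ^ 2\<close>
  unfinished rounds; the extra one is for the query answered by \<open>Finished\<close>.\<close>

lemma runs_in_rounds_hypothesis: "runs_in_rounds independent_set hypothesis (\<lambda>n. Suc (n ^ 2))"
  unfolding runs_in_rounds_def
proof (intro allI impI)
  fix n G T
  assume G: "graph_on n G" and T: "competent independent_set n G T"
  have "\<exists>k<Suc (n ^ 2). reply hypothesis T n k = Finished"
  proof (rule ccontr)
    assume unfinished: "\<not> ?thesis"
    \<comment> \<open>Each unfinished round costs at least one arc, so the sum never grows. At
      \<open>k = Suc (n ^ 2)\<close> the bound is absurd.\<close>
    have "card (parcs (query hypothesis T n k)) + k \<le> n ^ 2" if "k \<le> Suc (n ^ 2)" for k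
      using that
    proof (induction k)
      case 0
      have "parcs (query hypothesis T n 0) \<subseteq> {1..n} \<times> {1..n}"
        by (auto simp: query_def hypothesis_def)
      from card_mono[OF _ this] show ?case
        by (simp add: power2_eq_square)
    next
      case (Suc k)
      then show ?case
        using card_parcs_query_decreases[OF G T, of k] unfinished by force
    qed
    from this[of "Suc (n ^ 2)"] show False
      by simp
  qed
  then show "\<exists>k<Suc (n ^ 2). reply hypothesis T n k = Finished \<and>
      concept_equivalent independent_set G (query hypothesis T n k)"
    using correct_reply[OF T] by (metis correct_answer.simps(1))
qed

theorem theorem2p2:
  shows "\<exists>(L :: learner) (f :: nat \<Rightarrow> nat).
           learning_algorithm independent_set L \<and>
           runs_in_rounds independent_set L f \<and>
           (\<lambda>n. real (f n)) \<in> O(\<lambda>n. real n ^ 2)"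
proof (intro exI conjI)
  show "learning_algorithm independent_set hypothesis"
    using runs_in_rounds_hypothesis graph_on_hypothesis
    unfolding learning_algorithm_def learner_strategy_def runs_in_rounds_def by blast
  show "runs_in_rounds independent_set hypothesis (\<lambda>n. Suc (n ^ 2))"
    by (rule runs_in_rounds_hypothesis)
  \<comment> \<open>The factor 2 absorbs the added 1 once \<open>n \<ge> 1\<close>; at
    \<open>n = 0\<close> the right-hand side vanishes.\<close>
  have "real (Suc (n ^ 2)) \<le> 2 * real n ^ 2" if "n \<ge> 1" for n
    using one_le_power[of "real n" 2] that by simp
  then show "(\<lambda>n. real (Suc (n ^ 2))) \<in> O(\<lambda>n. real n ^ 2)"
    by (intro bigoI[of _ 2] eventually_sequentiallyI[of 1]) simp
qed

end
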